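(* Let $m_1,m_2,m_3$ be positive masses and let $\mathbf q=(\mathbf q_1,\mathbf q_2,\mathbf q_3)$ be a configuration on $\mathbb S^1$ with $d_{ij}\in(0,\pi)$ for all $i\neq j$. Then $\mathbf q$ is a Dziobek equilibrium configuration of the curved 3-body problem if and only if $\Delta_3\ne0$ and the masses satisfy $$(m_1,m_2,m_3)=\left(\frac{\sin^3 d_{12}\,\Delta_1}{\sin^3 d_{23}\,\Delta_3},\ \frac{\sin^3 d_{12}\,\Delta_2}{\sin^3 d_{13}\,\Delta_3},\ 1\right)m_3.$$
   Context: $\mathbb S^1$ is the unit circle of $\mathbb R^2$; $d_{ij}\in[0,\pi]$ is the geodesic distance, $\cos d_{ij}=\mathbf q_i\cdot\mathbf q_j$. The curved $N$-body potential is $V(\mathbf q)=-\sum_{1\le i<j\le N}m_im_j\cot d_{ij}$ (here $N=3$), defined when all $d_{ij}\in(0,\pi)$. An equilibrium configuration is a critical point of $V$, i.e. a configuration with $\sum_{j\ne i}\frac{m_im_j}{\sin^3 d_{ij}}[\mathbf q_j-\cos d_{ij}\,\mathbf q_i]=0$ for every $i$. A configuration of $N$ bodies is Dziobek if $\operatorname{rank}(\mathbf q_1,\dots,\mathbf q_N)=N-1$; a Dziobek equilibrium configuration is an equilibrium configuration that is Dziobek. $\Delta_k=(-1)^{k+1}\det X_k$, where $X_k$ is the $2\times2$ matrix obtained from $X=[\mathbf q_1,\mathbf q_2,\mathbf q_3]$ (columns $\mathbf q_i\in\mathbb R^2$) by deleting the $k$-th column. *)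

theory Defs
  imports "HOL-Analysis.Analysis"
begin

text \<open>Bodies are indexed by \<open>1, \<dots>, N\<close>; masses and positions are functions on \<^typ>\<open>nat\<close> of which
  only the values on \<^term>\<open>{1..N}\<close> matter.\<close>

definition geo_dist :: "real^2 \<Rightarrow> real^2 \<Rightarrow> real" where
  "geo_dist x y = arccos (x \<bullet> y)"

definition configuration :: "nat \<Rightarrow> (nat \<Rightarrow> real^2) \<Rightarrow> bool" where
  "configuration N q \<longleftrightarrow>
     (\<forall>i\<in>{1..N}. q i \<in> sphere 0 1) \<and>
     (\<forall>i\<in>{1..N}. \<forall>j\<in>{1..N}. i \<noteq> j \<longrightarrow> geo_dist (q i) (q j) \<in> {0<..<pi})"

definition potential :: "nat \<Rightarrow> (nat \<Rightarrow> real) \<Rightarrow> (nat \<Rightarrow> real^2) \<Rightarrow> real" where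
  "potential N m q =
     - (\<Sum>(i, j)\<in>{(i, j). 1 \<le> i \<and> i < j \<and> j \<le> N}. m i * m j * cot (geo_dist (q i) (q j)))"

text \<open>Critical points are those of the potential as a function on the manifold
  \<open>(\<bbbS>\<^sup>1)\<^sup>N\<close>: its derivative vanishes along every curve on the manifold through the point.\<close>

definition equilibrium :: "nat \<Rightarrow> (nat \<Rightarrow> real) \<Rightarrow> (nat \<Rightarrow> real^2) \<Rightarrow> bool" where
  "equilibrium N m q \<longleftrightarrow> configuration N q \<and>
     (\<forall>\<gamma> :: nat \<Rightarrow> real \<Rightarrow> real^2.
        (\<forall>i\<in>{1..N}. range (\<gamma> i) \<subseteq> sphere 0 1 \<and> \<gamma> i differentiable (at 0) \<and> \<gamma> i 0 = q i) \<longrightarrow>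
        ((\<lambda>t. potential N m (\<lambda>i. \<gamma> i t)) has_real_derivative 0) (at 0))"

text \<open>The rank of the matrix with columns \<open>q 1, \<dots>, q N\<close> is the dimension of their span; for
  \<open>N = 3\<close> see \<open>dim_eq_rank_3\<close> below.\<close>

definition dziobek :: "nat \<Rightarrow> (nat \<Rightarrow> real^2) \<Rightarrow> bool" where
  "dziobek N q \<longleftrightarrow> dim (q ` {1..N}) = N - 1"

definition dziobek_equilibrium :: "nat \<Rightarrow> (nat \<Rightarrow> real) \<Rightarrow> (nat \<Rightarrow> real^2) \<Rightarrow> bool" where
  "dziobek_equilibrium N m q \<longleftrightarrow> equilibrium N m q \<and> dziobek N q"

definition minor_matrix :: "(nat \<Rightarrow> real^2) \<Rightarrow> nat \<Rightarrow> real^2^2" where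
  "minor_matrix q k = transpose (vector (map q (filter (\<lambda>j. j \<noteq> k) [1, 2, 3])))"

definition Delta :: "(nat \<Rightarrow> real^2) \<Rightarrow> nat \<Rightarrow> real" where
  "Delta q k = (-1) ^ (k + 1) * det (minor_matrix q k)"

lemma dim_eq_rank_3:
  fixes q :: "nat \<Rightarrow> real^2"
  shows "dim (q ` {1..3}) = rank (transpose (vector [q 1, q 2, q 3]) :: real^3^2)"
proof -
  have "{1..3::nat} = {1, 2, 3}" by auto
  moreover have "rows (vector [q 1, q 2, q 3] :: real^2^3) = {q 1, q 2, q 3}"
    proof -
    have "rows (vector [q 1, q 2, q 3] :: real^2^3) = range (($) (vector [q 1, q 2, q 3] :: real^2^3))"
      by (auto simp: rows_def row_def)
    then show ?thesis
      unfolding UNIV_3 by (simp only: image_insert image_empty vector_3)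
  qed
  ultimately show ?thesis
    unfolding rank_transpose by (simp add: row_rank_def)
qed

lemma configuration_inner:
  assumes "configuration N q" "i \<in> {1..N}" "j \<in> {1..N}" "i \<noteq> j"
  shows "\<bar>q i \<bullet> q j\<bar> < 1"
    and "cos (geo_dist (q i) (q j)) = q i \<bullet> q j"
    and "sin (geo_dist (q i) (q j)) = sqrt (1 - (q i \<bullet> q j)\<^sup>2)"
proof -
  have n: "norm (q i) = 1" "norm (q j) = 1" and d: "arccos (q i \<bullet> q j) \<in> {0<..<pi}"
    using assms by (auto simp: configuration_def geo_dist_def)
  have le: "\<bar>q i \<bullet> q j\<bar> \<le> 1"
    using Cauchy_Schwarz_ineq2[of "q i" "q j"] n by simp
  moreover have "q i \<bullet> q j \<noteq> 1" "q i \<bullet> q j \<noteq> -1"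
    using d by auto
  ultimately show "\<bar>q i \<bullet> q j\<bar> < 1" by linarith
  show "cos (geo_dist (q i) (q j)) = q i \<bullet> q j"
    "sin (geo_dist (q i) (q j)) = sqrt (1 - (q i \<bullet> q j)\<^sup>2)"
    using le by (auto simp: geo_dist_def sin_arccos_abs)
qed

lemma cot_geo_dist_has_derivative:
  assumes "configuration N q" "i \<in> {1..N}" "j \<in> {1..N}" "i \<noteq> j"
    and "(\<gamma> i has_vector_derivative v i) (at 0)" "\<gamma> i 0 = q i"
    and "(\<gamma> j has_vector_derivative v j) (at 0)" "\<gamma> j 0 = q j"
  shows "((\<lambda>t. cot (geo_dist (\<gamma> i t) (\<gamma> j t))) has_real_derivative
    (v i \<bullet> q j + v j \<bullet> q i) / sin (geo_dist (q i) (q j)) ^ 3) (at 0)"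
proof -
  let ?d = "geo_dist (q i) (q j)"
  have lt: "\<bar>q i \<bullet> q j\<bar> < 1" and s: "sin ?d = sqrt (1 - (q i \<bullet> q j)\<^sup>2)"
    using configuration_inner[OF assms(1-4)] by auto
  have s0: "sin ?d > 0"
    using s lt by (simp add: abs_square_less_1)
  have "((\<lambda>t. \<gamma> i t \<bullet> \<gamma> j t) has_vector_derivative (q i \<bullet> v j + v i \<bullet> q j)) (at 0)"
    using bounded_bilinear.has_vector_derivative[OF bounded_bilinear_inner assms(5,7)] assms(6,8)
    by simp
  then have D1: "((\<lambda>t. \<gamma> i t \<bullet> \<gamma> j t) has_real_derivative (q i \<bullet> v j + v i \<bullet> q j)) (at 0)"
    by (simp add: has_real_derivative_iff_has_vector_derivative)
  have "((\<lambda>t. arccos (\<gamma> i t \<bullet> \<gamma> j t)) has_real_derivative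
      inverse (- sqrt (1 - (q i \<bullet> q j)\<^sup>2)) * (q i \<bullet> v j + v i \<bullet> q j)) (at 0)"
    by (rule DERIV_chain2[OF _ D1]) (use lt assms DERIV_arccos[of "q i \<bullet> q j"] in auto)
  then have D2: "((\<lambda>t. geo_dist (\<gamma> i t) (\<gamma> j t)) has_real_derivative
      inverse (- sin ?d) * (q i \<bullet> v j + v i \<bullet> q j)) (at 0)"
    by (simp add: geo_dist_def[abs_def] s[unfolded geo_dist_def])
  have "((\<lambda>t. cot (geo_dist (\<gamma> i t) (\<gamma> j t))) has_real_derivative
      - inverse ((sin ?d)\<^sup>2) * (inverse (- sin ?d) * (q i \<bullet> v j + v i \<bullet> q j))) (at 0)"
    by (rule DERIV_chain2[OF _ D2]) (use s0 assms in \<open>auto intro!: DERIV_cot\<close>)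
  then show ?thesis
    using s0 by (simp add: field_simps power2_eq_square power3_eq_cube inner_commute)
qed

lemma sum_pairs_symmetric:
  fixes a :: "nat \<Rightarrow> nat \<Rightarrow> real"
  shows "(\<Sum>(i, j)\<in>{(i, j). 1 \<le> i \<and> i < j \<and> j \<le> N}. a i j + a j i) =
    (\<Sum>i\<in>{1..N}. \<Sum>j\<in>{1..N} - {i}. a i j)"
proof -
  let ?P = "{(i::nat, j). 1 \<le> i \<and> i < j \<and> j \<le> N}" and ?Q = "{(i::nat, j). 1 \<le> j \<and> j < i \<and> i \<le> N}"
  have fin: "finite ?P" "finite ?Q"
    by (rule finite_subset[of _ "{1..N} \<times> {1..N}"]; auto)+
  have "(\<Sum>(i, j)\<in>?P. a j i) = (\<Sum>(i, j)\<in>?Q. a i j)"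
    by (rule sum.reindex_bij_witness[of _ prod.swap prod.swap]) auto
  then have "(\<Sum>(i, j)\<in>?P. a i j + a j i) = (\<Sum>(i, j)\<in>?P. a i j) + (\<Sum>(i, j)\<in>?Q. a i j)"
    by (simp add: sum.distrib case_prod_unfold)
  also have "\<dots> = (\<Sum>(i, j)\<in>?P \<union> ?Q. a i j)"
    by (rule sum.union_disjoint[symmetric]) (use fin in auto)
  also have "?P \<union> ?Q = (SIGMA i:{1..N}. {1..N} - {i})"
    by auto
  finally show ?thesis
    by (simp add: sum.Sigma)
qed

lemma potential_has_derivative:
  assumes q: "configuration N q"
    and \<gamma>: "\<And>i. i \<in> {1..N} \<Longrightarrow> (\<gamma> i has_vector_derivative v i) (at 0) \<and> \<gamma> i 0 = q i"
    and orth: "\<And>i. i \<in> {1..N} \<Longrightarrow> v i \<bullet> q i = 0"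
  shows "((\<lambda>t. potential N m (\<lambda>i. \<gamma> i t)) has_real_derivative
    - (\<Sum>i\<in>{1..N}. v i \<bullet> (\<Sum>j\<in>{1..N} - {i}. (m i * m j / sin (geo_dist (q i) (q j)) ^ 3) *\<^sub>R
        (q j - cos (geo_dist (q i) (q j)) *\<^sub>R q i)))) (at 0)"
proof -
  let ?P = "{(i::nat, j). 1 \<le> i \<and> i < j \<and> j \<le> N}"
  let ?s = "\<lambda>i j. sin (geo_dist (q i) (q j)) ^ 3"
  define a where "a i j = m i * m j / ?s i j * (v i \<bullet> q j)" for i j
  have sym: "?s i j = ?s j i" for i j
    by (simp add: geo_dist_def inner_commute)
  have "((\<lambda>t. \<Sum>p\<in>?P. m (fst p) * m (snd p) * cot (geo_dist (\<gamma> (fst p) t) (\<gamma> (snd p) t)))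
      has_real_derivative (\<Sum>p\<in>?P. a (fst p) (snd p) + a (snd p) (fst p))) (at 0)"
  proof (rule DERIV_sum)
    fix p assume "p \<in> ?P"
    then obtain i j where p: "p = (i, j)" and ij: "i \<in> {1..N}" "j \<in> {1..N}" "i \<noteq> j"
      by auto
    have "((\<lambda>t. m i * m j * cot (geo_dist (\<gamma> i t) (\<gamma> j t))) has_real_derivative
        m i * m j * ((v i \<bullet> q j + v j \<bullet> q i) / ?s i j)) (at 0)"
      by (rule DERIV_cmult, rule cot_geo_dist_has_derivative[OF q ij]) (use \<gamma> ij in auto)
    also have "m i * m j * ((v i \<bullet> q j + v j \<bullet> q i) / ?s i j) = a i j + a j i"
      unfolding a_def sym[of j i] by (simp add: algebra_simps add_divide_distrib)
    finally show "((\<lambda>t. m (fst p) * m (snd p) * cot (geo_dist (\<gamma> (fst p) t) (\<gamma> (snd p) t)))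
      has_real_derivative a (fst p) (snd p) + a (snd p) (fst p)) (at 0)"
      by (simp add: p)
  qed
  then have "((\<lambda>t. potential N m (\<lambda>i. \<gamma> i t)) has_real_derivative
      - (\<Sum>p\<in>?P. a (fst p) (snd p) + a (snd p) (fst p))) (at 0)"
    unfolding potential_def case_prod_unfold by (rule DERIV_minus)
  moreover have "(\<Sum>p\<in>?P. a (fst p) (snd p) + a (snd p) (fst p)) =
      (\<Sum>i\<in>{1..N}. \<Sum>j\<in>{1..N} - {i}. a i j)"
    using sum_pairs_symmetric[of a N] by (simp only: case_prod_unfold)
  moreover have "\<dots> = (\<Sum>i\<in>{1..N}. v i \<bullet> (\<Sum>j\<in>{1..N} - {i}. (m i * m j / ?s i j) *\<^sub>R
        (q j - cos (geo_dist (q i) (q j)) *\<^sub>R q i)))"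
    by (rule sum.cong[OF refl]) (simp add: inner_sum_right inner_diff_right orth a_def)
  ultimately show ?thesis by simp
qed

lemma equilibrium_iff:
  "equilibrium N m q \<longleftrightarrow> configuration N q \<and>
     (\<forall>i\<in>{1..N}. (\<Sum>j\<in>{1..N} - {i}. (m i * m j / sin (geo_dist (q i) (q j)) ^ 3) *\<^sub>R
        (q j - cos (geo_dist (q i) (q j)) *\<^sub>R q i)) = 0)"
proof -
  define F where "F i = (\<Sum>j\<in>{1..N} - {i}. (m i * m j / sin (geo_dist (q i) (q j)) ^ 3) *\<^sub>R
        (q j - cos (geo_dist (q i) (q j)) *\<^sub>R q i))" for i
  have crit: "((\<lambda>t. potential N m (\<lambda>i. \<gamma> i t)) has_real_derivative
      - (\<Sum>i\<in>{1..N}. v i \<bullet> F i)) (at 0)"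
    if "configuration N q"
      "\<And>i. i \<in> {1..N} \<Longrightarrow> (\<gamma> i has_vector_derivative v i) (at 0) \<and> \<gamma> i 0 = q i"
      "\<And>i. i \<in> {1..N} \<Longrightarrow> v i \<bullet> q i = 0" for \<gamma> v
    using potential_has_derivative[OF that] unfolding F_def .
  show ?thesis
    unfolding F_def[symmetric]
  proof (intro iffI conjI ballI)
    assume eq: "equilibrium N m q"
    then show q: "configuration N q"
      by (simp add: equilibrium_def)
    fix k assume k: "k \<in> {1..N}"
    have qq: "q i \<bullet> q i = 1" if "i \<in> {1..N}" for i
      using q that by (auto simp: configuration_def norm_eq_1)
    have Fk: "F k \<bullet> q k = 0"
      unfolding F_def inner_sum_left
    proof (rule sum.neutral, rule ballI)
      fix j assume "j \<in> {1..N} - {k}"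
      then have "cos (geo_dist (q k) (q j)) = q k \<bullet> q j"
        using configuration_inner(2)[OF q k] by auto
      then show "(m k * m j / sin (geo_dist (q k) (q j)) ^ 3) *\<^sub>R
          (q j - cos (geo_dist (q k) (q j)) *\<^sub>R q k) \<bullet> q k = 0"
        using qq[OF k] by (simp add: inner_diff_left inner_diff_right inner_commute[of "q j"])
    qed
    define \<gamma> where "\<gamma> i t = (if i = k \<and> F k \<noteq> 0 then cos t *\<^sub>R q k + sin t *\<^sub>R sgn (F k) else q i)"
      for i and t :: real
    define v where "v i = (if i = k then sgn (F k) else 0)" for i
    have der: "(\<gamma> i has_vector_derivative v i) (at 0)" for i
      unfolding \<gamma>_def[abs_def] v_def
      by (cases "i = k \<and> F k \<noteq> 0") (auto intro!: derivative_eq_intros)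
    have sph: "norm (\<gamma> i t) = 1" if "i \<in> {1..N}" for i t
    proof (cases "i = k \<and> F k \<noteq> 0")
      case True
      then have "sgn (F k) \<bullet> sgn (F k) = 1"
        by (simp add: norm_eq_1[symmetric] norm_sgn)
      moreover have "sgn (F k) \<bullet> q k = 0"
        using Fk by (simp add: sgn_div_norm)
      ultimately have "\<gamma> i t \<bullet> \<gamma> i t = (cos t)\<^sup>2 + (sin t)\<^sup>2"
        using True qq[OF k]
        by (simp add: \<gamma>_def inner_add_left inner_add_right inner_commute power2_eq_square)
      then show ?thesis by (simp add: norm_eq_1)
    next
      case False
      then show ?thesis using qq[OF that] by (auto simp: \<gamma>_def norm_eq_1)
    qed
    have g0: "\<gamma> i 0 = q i" for i
      by (simp add: \<gamma>_def)
    have vq: "v i \<bullet> q i = 0" for i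
      using Fk by (simp add: v_def sgn_div_norm)
    have "((\<lambda>t. potential N m (\<lambda>i. \<gamma> i t)) has_real_derivative - (\<Sum>i\<in>{1..N}. v i \<bullet> F i)) (at 0)"
      by (rule crit[OF q]) (use der g0 vq in auto)
    moreover have "\<forall>i\<in>{1..N}. range (\<gamma> i) \<subseteq> sphere 0 1 \<and> \<gamma> i differentiable (at 0) \<and> \<gamma> i 0 = q i"
      using sph g0 der differentiableI_vector by fastforce
    then have "((\<lambda>t. potential N m (\<lambda>i. \<gamma> i t)) has_real_derivative 0) (at 0)"
      using eq unfolding equilibrium_def by blast
    ultimately have "(\<Sum>i\<in>{1..N}. v i \<bullet> F i) = 0"
      using DERIV_unique by fastforce
    moreover have "(\<Sum>i\<in>{1..N}. v i \<bullet> F i) = (\<Sum>i\<in>{1..N}. if i = k then norm (F k) else 0)"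
      by (rule sum.cong) (auto simp: v_def sgn_div_norm dot_square_norm power2_eq_square field_simps)
    ultimately show "F k = 0"
      using k by simp
  next
    assume "configuration N q \<and> (\<forall>i\<in>{1..N}. F i = 0)"
    then have q: "configuration N q" and F: "\<And>i. i \<in> {1..N} \<Longrightarrow> F i = 0"
      by auto
    show "equilibrium N m q"
      unfolding equilibrium_def
    proof (intro conjI allI impI q)
      fix \<gamma> :: "nat \<Rightarrow> real \<Rightarrow> real^2"
      assume \<gamma>: "\<forall>i\<in>{1..N}. range (\<gamma> i) \<subseteq> sphere 0 1 \<and> \<gamma> i differentiable (at 0) \<and> \<gamma> i 0 = q i"
      define v where "v i = vector_derivative (\<gamma> i) (at 0)" for i
      have der: "(\<gamma> i has_vector_derivative v i) (at 0) \<and> \<gamma> i 0 = q i" if "i \<in> {1..N}" for i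
        using \<gamma> that by (auto simp: v_def vector_derivative_works)
      have orth: "v i \<bullet> q i = 0" if "i \<in> {1..N}" for i
      proof -
        have "((\<lambda>t. \<gamma> i t \<bullet> \<gamma> i t) has_vector_derivative (q i \<bullet> v i + v i \<bullet> q i)) (at 0)"
          using bounded_bilinear.has_vector_derivative[OF bounded_bilinear_inner, of "\<gamma> i" "v i" 0 UNIV "\<gamma> i" "v i"]
            der[OF that] by simp
        moreover have "(\<lambda>t. \<gamma> i t \<bullet> \<gamma> i t) = (\<lambda>_. 1)"
          using \<gamma> that by (auto simp: norm_eq_1[symmetric] image_subset_iff)
        ultimately have "q i \<bullet> v i + v i \<bullet> q i = 0"
          using has_vector_derivative_const vector_derivative_unique_at by metis
        then show ?thesis by (simp add: inner_commute)
      qed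
      show "((\<lambda>t. potential N m (\<lambda>i. \<gamma> i t)) has_real_derivative 0) (at 0)"
        using crit[OF q der orth] F by simp
    qed
  qed
qed

end

(* For unit vectors u, v of the plane, v - (u . v) u = det(u, v) J u, where J is the rotation by a
   right angle, and det(u, v)^2 = sin^2 d(u, v).  Hence no determinant vanishes, every configuration
   is Dziobek, and the equilibrium equations become the linear system
   sum_j m_j det(q_i, q_j) / sin^3 d_ij = 0.  Its matrix is skew-symmetric of order 3, so the
   equations for i = 1, 2 imply the third one, and solving them for m_1 and m_2 gives the
   stated ratios. *)
theory Submission
  imports Defs
begin

definition cross2 :: "real^2 \<Rightarrow> real^2 \<Rightarrow> real" where
  "cross2 x y = x $ 1 * y $ 2 - x $ 2 * y $ 1"

text \<open>The counterclockwise rotation J; on a unit vector it gives a unit tangent to the circle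
  there.\<close>

definition perp :: "real^2 \<Rightarrow> real^2" where
  "perp x = vector [- x $ 2, x $ 1]"

lemma cross2_commute: "cross2 y x = - cross2 x y"
  by (simp add: cross2_def)

text \<open>Lagrange's identity in the plane.\<close>

lemma cross2_squared: "(cross2 x y)\<^sup>2 = (x \<bullet> x) * (y \<bullet> y) - (x \<bullet> y)\<^sup>2"
  by (simp add: cross2_def inner_vec_def sum_2 power2_eq_square algebra_simps)

text \<open>For a unit vector \<open>x\<close> the left side is the component of \<open>y\<close>
  tangent to the circle at \<open>x\<close>. The factor \<open>x \<bullet> x\<close> makes this a
  polynomial identity in the coordinates.\<close>

lemma inner_scaled_diff_eq_perp:
  "(x \<bullet> x) *\<^sub>R y - (x \<bullet> y) *\<^sub>R x = cross2 x y *\<^sub>R perp x"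
  by (simp add: vec_eq_iff forall_2 cross2_def perp_def inner_vec_def sum_2 algebra_simps)

lemma perp_eq_0_iff: "perp x = 0 \<longleftrightarrow> x = 0"
  by (auto simp: perp_def vec_eq_iff forall_2)

lemma span_eq_UNIV_of_cross2:
  assumes "cross2 x y \<noteq> 0" and "{x, y} \<subseteq> S"
  shows "span S = UNIV"
proof -
  have "z \<in> span S" for z
  proof -
    \<comment> \<open>Cramer's rule with the denominator cleared.\<close>
    have "cross2 x y *\<^sub>R z = cross2 z y *\<^sub>R x + cross2 x z *\<^sub>R y"
      by (simp add: vec_eq_iff forall_2 cross2_def algebra_simps)
    then have "cross2 x y *\<^sub>R z \<in> span S"
      using assms(2) by (simp add: span_add span_scale span_base)
    then show ?thesis
      using span_scale[of "cross2 x y *\<^sub>R z" S "inverse (cross2 x y)"] assms(1) by simp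
  qed
  then show ?thesis by auto
qed

lemma Delta_eq_cross2:
  "Delta q 1 = cross2 (q 2) (q 3)"
  "Delta q 2 = - cross2 (q 1) (q 3)"
  "Delta q 3 = cross2 (q 1) (q 2)"
  by (simp_all add: Delta_def minor_matrix_def det_2 transpose_def cross2_def)

lemma configuration_inner_self:
  assumes "configuration N q" and "i \<in> {1..N}"
  shows "q i \<bullet> q i = 1"
  using assms by (auto simp: configuration_def norm_eq_1)

lemma configuration_sin_pos:
  assumes "configuration N q" and "i \<in> {1..N}" and "j \<in> {1..N}" and "i \<noteq> j"
  shows "sin (geo_dist (q i) (q j)) > 0"
  using assms by (auto simp: configuration_def intro: sin_gt_zero)

text \<open>On unit vectors Lagrange's identity reads
  \<open>1 - (q i \<bullet> q j)\<^sup>2\<close>, which is positive because the distance avoids 0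
  and \<open>pi\<close>.\<close>

lemma configuration_cross2_nonzero:
  assumes "configuration N q" and "i \<in> {1..N}" and "j \<in> {1..N}" and "i \<noteq> j"
  shows "cross2 (q i) (q j) \<noteq> 0"
  using cross2_squared[of "q i" "q j"] configuration_inner(1)[OF assms]
    configuration_inner_self[OF assms(1)] assms
  by (auto simp: abs_square_eq_1)

lemma dziobek_3:
  assumes "configuration 3 q"
  shows "dziobek 3 q"
proof -
  have "span (q ` {1..3}) = UNIV"
    by (rule span_eq_UNIV_of_cross2[OF configuration_cross2_nonzero[OF assms, of 1 2]]) auto
  then show ?thesis
    using dim_span[of "q ` {1..3}"] by (simp add: dziobek_def)
qed

text \<open>Every term of the force on body \<open>i\<close> is a multiple of the nonzero tangent
  \<open>perp (q i)\<close>, so each vector equation is one scalar equation, from which the factor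
  \<open>m i\<close> cancels.\<close>

lemma equilibrium_iff_cross2:
  assumes q: "configuration N q" and m: "\<And>i. i \<in> {1..N} \<Longrightarrow> m i \<noteq> 0"
  shows "equilibrium N m q \<longleftrightarrow>
    (\<forall>i\<in>{1..N}. (\<Sum>j\<in>{1..N} - {i}. m j * cross2 (q i) (q j) / sin (geo_dist (q i) (q j)) ^ 3) = 0)"
proof -
  let ?s = "\<lambda>i j. sin (geo_dist (q i) (q j)) ^ 3"
  have "(\<Sum>j\<in>{1..N} - {i}. (m i * m j / ?s i j) *\<^sub>R (q j - cos (geo_dist (q i) (q j)) *\<^sub>R q i)) =
      (m i * (\<Sum>j\<in>{1..N} - {i}. m j * cross2 (q i) (q j) / ?s i j)) *\<^sub>R perp (q i)"
    if i: "i \<in> {1..N}" for i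
    unfolding sum_distrib_left scaleR_sum_left
  proof (rule sum.cong[OF refl])
    fix j assume "j \<in> {1..N} - {i}"
    then have "q j - cos (geo_dist (q i) (q j)) *\<^sub>R q i = cross2 (q i) (q j) *\<^sub>R perp (q i)"
      using inner_scaled_diff_eq_perp[of "q i" "q j"] configuration_inner(2)[OF q i, of j]
        configuration_inner_self[OF q i] by auto
    then show "(m i * m j / ?s i j) *\<^sub>R (q j - cos (geo_dist (q i) (q j)) *\<^sub>R q i) =
        (m i * (m j * cross2 (q i) (q j) / ?s i j)) *\<^sub>R perp (q i)"
      by simp
  qed
  moreover have "perp (q i) \<noteq> 0" if "i \<in> {1..N}" for i
    using configuration_inner_self[OF q that] by (auto simp: perp_eq_0_iff)
  ultimately show ?thesis
    using q m by (simp add: equilibrium_iff)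
qed

theorem corollary1:
  fixes m :: "nat \<Rightarrow> real" and q :: "nat \<Rightarrow> real^2"
  assumes "m 1 > 0" and "m 2 > 0" and "m 3 > 0"
    and "configuration 3 q"
  shows "dziobek_equilibrium 3 m q \<longleftrightarrow>
    Delta q 3 \<noteq> 0 \<and>
    (m 1, m 2, m 3) =
      m 3 *\<^sub>R (sin (geo_dist (q 1) (q 2)) ^ 3 * Delta q 1 / (sin (geo_dist (q 2) (q 3)) ^ 3 * Delta q 3),
              sin (geo_dist (q 1) (q 2)) ^ 3 * Delta q 2 / (sin (geo_dist (q 1) (q 3)) ^ 3 * Delta q 3),
              1)"
proof -
  have I: "{1..3::nat} = {1, 2, 3}" by auto
  have m_nonzero: "m i \<noteq> 0" if "i \<in> {1..3}" for i
    using that assms(1-3) unfolding I by auto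
  define s where "s i j = sin (geo_dist (q i) (q j)) ^ 3" for i j
  define c where "c i j = cross2 (q i) (q j)" for i j
  have s_sym: "s j i = s i j" for i j
    by (simp add: s_def geo_dist_def inner_commute)
  have c_skew: "c j i = - c i j" for i j
    unfolding c_def by (rule cross2_commute)
  have s_pos: "s 1 2 > 0" "s 1 3 > 0" "s 2 3 > 0"
    using configuration_sin_pos[OF assms(4)] by (simp_all add: s_def)
  have c_12: "c 1 2 \<noteq> 0"
    using configuration_cross2_nonzero[OF assms(4), of 1 2] by (simp add: c_def)
  have "dziobek_equilibrium 3 m q \<longleftrightarrow>
      (\<forall>i\<in>{1..3}. (\<Sum>j\<in>{1..3} - {i}. m j * c i j / s i j) = 0)"
    unfolding dziobek_equilibrium_def c_def s_def
    using equilibrium_iff_cross2[OF assms(4), of m, OF m_nonzero] dziobek_3[OF assms(4)] by blast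
  also have "\<dots> \<longleftrightarrow> m 2 * c 1 2 / s 1 2 + m 3 * c 1 3 / s 1 3 = 0 \<and>
      m 3 * c 2 3 / s 2 3 - m 1 * c 1 2 / s 1 2 = 0 \<and>
      m 1 * c 1 3 / s 1 3 + m 2 * c 2 3 / s 2 3 = 0"
    unfolding I
    by (simp add: insert_Diff_if s_sym[of 2 1] s_sym[of 3 1] s_sym[of 3 2]
        c_skew[of 2 1] c_skew[of 3 1] c_skew[of 3 2]
        neg_eq_iff_add_eq_0 del: One_nat_def)
  also have "\<dots> \<longleftrightarrow> m 2 * c 1 2 / s 1 2 + m 3 * c 1 3 / s 1 3 = 0 \<and>
      m 3 * c 2 3 / s 2 3 - m 1 * c 1 2 / s 1 2 = 0"
  proof -
    \<comment> \<open>Skew-symmetry makes the mass-weighted sum of the three equations vanish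
      identically; the third one appears here with its sign reversed.\<close>
    have "m 3 * (m 1 * c 1 3 / s 1 3 + m 2 * c 2 3 / s 2 3) =
        m 1 * (m 2 * c 1 2 / s 1 2 + m 3 * c 1 3 / s 1 3) +
        m 2 * (m 3 * c 2 3 / s 2 3 - m 1 * c 1 2 / s 1 2)"
      by (simp add: algebra_simps)
    then show ?thesis using assms(3) by auto
  qed
  \<comment> \<open>The second equation determines \<open>m 1\<close>, the first \<open>m 2\<close>;
    the minus sign before \<open>c 1 3\<close> is the one in \<open>Delta q 2\<close>.\<close>
  also have "\<dots> \<longleftrightarrow> m 1 = m 3 * (s 1 2 * c 2 3 / (s 2 3 * c 1 2)) \<and>
      m 2 = m 3 * (s 1 2 * - c 1 3 / (s 1 3 * c 1 2))"
    using s_pos c_12 by (auto simp: field_simps)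
  finally show ?thesis
    using c_12 unfolding Delta_eq_cross2 s_def c_def by simp
qed

end
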